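(* Let $G_1$ and $G_2$ be two simple graphs. If $\theta$ is a graph homomorphism from $G_1$ to $G_2$, then $$\mathbb{K}_k\text{-cover}_{\mathrm{f}}(G_1)\leq \mathbb{K}_k\text{-cover}_{\mathrm{f}}(G_2)$$ for any integer $k\geq 1$.
   Context: All graphs are finite and simple (no loops or multiple edges), with non-empty vertex set. The clique number $\omega(G)$ is the largest number of vertices of $G$ inducing a complete subgraph. For an integer $k\geq 1$, $\mathbb{K}_k$ is the class of graphs not containing a $(k+1)$-clique. $\mathbb{K}_k(G)$ denotes the set of induced subgraphs of $G$ belonging to $\mathbb{K}_k$, and for $v\in V(G)$, $\mathbb{K}_k(G,v)$ denotes the set of those elements of $\mathbb{K}_k(G)$ that contain $v$. A fractional $\mathbb{K}_k$-cover of $G$ is a function $f:\mathbb{K}_k(G)\to[0,1]$ such that $\sum_{H\in\mathbb{K}_k(G,v)}f(H)\geq 1$ for every $v\in V(G)$. Its weight is $\sum_{H\in\mathbb{K}_k(G)}f(H)$. The fractional $\mathbb{K}_k$-cover number of $G$, denoted $\mathbb{K}_k\text{-cover}_{\mathrm{f}}(G)$, is the minimum weight over all fractional $\mathbb{K}_k$-covers of $G$. For $k>\omega(G)$, $\mathbb{K}_k\text{-cover}_{\mathrm{f}}(G)$ is defined to be $1$ (consistent with the general definition). *)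

theory Defs
  imports "HOL-Analysis.Analysis" "Graph_Theory.Digraph_Component"
begin

text \<open>
  The locale predicate \<open>graph\<close> describes finite symmetric digraphs without loops and without
  parallel arcs; an undirected edge is a pair of opposite arcs.  Here every graph is moreover
  required to have a vertex.
\<close>

definition simple_graph :: "('a, 'b) pre_digraph \<Rightarrow> bool" where
  "simple_graph G \<longleftrightarrow> graph G \<and> verts G \<noteq> {}"

definition clique :: "('a, 'b) pre_digraph \<Rightarrow> 'a set \<Rightarrow> bool" where
  "clique G W \<longleftrightarrow> W \<subseteq> verts G \<and> (\<forall>u\<in>W. \<forall>v\<in>W. u \<noteq> v \<longrightarrow> u \<rightarrow>\<^bsub>G\<^esub> v)"

definition clique_number :: "('a, 'b) pre_digraph \<Rightarrow> nat" where
  "clique_number G = Max {card W | W. clique G W}"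

definition graph_hom ::
  "('a, 'b) pre_digraph \<Rightarrow> ('c, 'd) pre_digraph \<Rightarrow> ('a \<Rightarrow> 'c) \<Rightarrow> bool" where
  "graph_hom G\<^sub>1 G\<^sub>2 \<theta> \<longleftrightarrow>
     (\<forall>v\<in>verts G\<^sub>1. \<theta> v \<in> verts G\<^sub>2) \<and> (\<forall>u v. u \<rightarrow>\<^bsub>G\<^sub>1\<^esub> v \<longrightarrow> \<theta> u \<rightarrow>\<^bsub>G\<^sub>2\<^esub> \<theta> v)"

definition K_class :: "nat \<Rightarrow> ('a, 'b) pre_digraph set" where
  "K_class k = {G. simple_graph G \<and> \<not> (\<exists>W. clique G W \<and> card W = k + 1)}"

definition K_sub :: "nat \<Rightarrow> ('a, 'b) pre_digraph \<Rightarrow> ('a, 'b) pre_digraph set" where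
  "K_sub k G = {H. induced_subgraph H G \<and> H \<in> K_class k}"

definition K_sub_at :: "nat \<Rightarrow> ('a, 'b) pre_digraph \<Rightarrow> 'a \<Rightarrow> ('a, 'b) pre_digraph set" where
  "K_sub_at k G v = {H \<in> K_sub k G. v \<in> verts H}"

text \<open>
  A cover is a total function of which only the values on \<open>K_sub k G\<close> matter.
\<close>

definition frac_K_cover ::
  "nat \<Rightarrow> ('a, 'b) pre_digraph \<Rightarrow> (('a, 'b) pre_digraph \<Rightarrow> real) \<Rightarrow> bool" where
  "frac_K_cover k G f \<longleftrightarrow>
     (\<forall>H\<in>K_sub k G. 0 \<le> f H \<and> f H \<le> 1) \<and>
     (\<forall>v\<in>verts G. (\<Sum>H\<in>K_sub_at k G v. f H) \<ge> 1)"

definition K_weight ::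
  "nat \<Rightarrow> ('a, 'b) pre_digraph \<Rightarrow> (('a, 'b) pre_digraph \<Rightarrow> real) \<Rightarrow> real" where
  "K_weight k G f = (\<Sum>H\<in>K_sub k G. f H)"

text \<open>
  The minimum is written as an infimum; it is attained for every \<open>k \<ge> 1\<close>, see
  \<open>K_cover_f_attained\<close> below.  No separate clause is needed for \<open>k\<close> larger than the clique
  number, see \<open>K_cover_f_eq_1\<close>.
\<close>

definition K_cover_f :: "nat \<Rightarrow> ('a, 'b) pre_digraph \<Rightarrow> real" where
  "K_cover_f k G = Inf {K_weight k G f | f. frac_K_cover k G f}"

lemma finite_K_sub:
  fixes G :: "('a, 'b) pre_digraph"
  assumes "simple_graph G"
  shows "finite (K_sub k G)"
proof -
  interpret graph G using assms by (simp add: simple_graph_def)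
  have "inj_on verts (K_sub k G)"
    by (rule inj_onI)
       (auto simp: K_sub_def induced_subgraph_def subgraph_def compatible_def
             intro!: pre_digraph.equality)
  moreover have "verts ` K_sub k G \<subseteq> Pow (verts G)"
    by (auto simp: K_sub_def induced_subgraph_def subgraph_def)
  ultimately show ?thesis
    by (metis finite_Pow_iff finite_imageD finite_subset finite_verts)
qed

lemma singleton_in_K_sub:
  assumes "simple_graph G" "v \<in> verts G" "k \<ge> 1"
  shows "G \<restriction> {v} \<in> K_sub k G"
proof -
  interpret graph G using assms by (simp add: simple_graph_def)
  have ind: "induced_subgraph (G \<restriction> {v}) G"
    using assms by (intro induced_induce) auto
  have "graph (G \<restriction> {v})"
    using ind by (meson digraphI_induced graph_def induced_graph_imp_graph pseudo_graph_def
        digraph_def)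
  moreover have "\<not> clique (G \<restriction> {v}) W" if "card W = k + 1" for W
  proof
    assume "clique (G \<restriction> {v}) W"
    then have "W \<subseteq> {v}" by (simp add: clique_def)
    then have "card W \<le> 1" by (metis card.empty card_insert_disjoint card_mono empty_iff
          finite.emptyI finite.insertI One_nat_def)
    with that assms show False by simp
  qed
  ultimately show ?thesis
    using ind by (auto simp: K_sub_def K_class_def simple_graph_def)
qed

lemma frac_K_cover_one:
  assumes "simple_graph G" "k \<ge> 1"
  shows "frac_K_cover k G (\<lambda>_. 1)"
proof -
  have "K_sub_at k G v \<noteq> {}" if "v \<in> verts G" for v
    using singleton_in_K_sub[OF assms(1) that assms(2)] by (auto simp: K_sub_at_def)
  moreover have "finite (K_sub_at k G v)" for v
    using finite_K_sub[OF assms(1)] by (simp add: K_sub_at_def)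
  ultimately show ?thesis
    by (auto simp: frac_K_cover_def Suc_le_eq card_gt_0_iff)
qed

lemma K_cover_f_attained:
  fixes G :: "('a, 'b) pre_digraph"
  assumes "simple_graph G" "k \<ge> 1"
  obtains f where "frac_K_cover k G f" "K_weight k G f = K_cover_f k G"
    "\<And>g. frac_K_cover k G g \<Longrightarrow> K_weight k G f \<le> K_weight k G g"
proof -
  define C where "C = {f :: ('a, 'b) pre_digraph \<Rightarrow> real.
      (\<forall>H. f H \<in> {0..1}) \<and> (\<forall>v\<in>verts G. (\<Sum>H\<in>K_sub_at k G v. f H) \<ge> 1)}"
  have "compact (PiE UNIV (\<lambda>_ :: ('a, 'b) pre_digraph. {0..1::real}))"
    using compactin_PiE[of "\<lambda>_. euclidean" UNIV "\<lambda>_ :: ('a, 'b) pre_digraph. {0..1::real}"]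
    by (simp add: euclidean_product_topology)
  moreover have "closed {f :: ('a, 'b) pre_digraph \<Rightarrow> real.
      (\<forall>v\<in>verts G. (\<Sum>H\<in>K_sub_at k G v. f H) \<ge> 1)}"
    unfolding Ball_def
    by (intro closed_Collect_all closed_Collect_imp open_Collect_const closed_Collect_le continuous_intros
        continuous_on_product_coordinates)
  moreover have "C = PiE UNIV (\<lambda>_. {0..1}) \<inter>
      {f. \<forall>v\<in>verts G. (\<Sum>H\<in>K_sub_at k G v. f H) \<ge> 1}"
    by (auto simp: C_def PiE_def Pi_def)
  ultimately have "compact C" by auto
  moreover have "(\<lambda>_. 1) \<in> C"
    using frac_K_cover_one[OF assms] by (auto simp: C_def frac_K_cover_def)
  moreover have "continuous_on C (K_weight k G)"
    unfolding K_weight_def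
    by (intro continuous_intros continuous_on_subset[OF continuous_on_product_coordinates]) auto
  ultimately obtain f where f: "f \<in> C" "\<And>g. g \<in> C \<Longrightarrow> K_weight k G f \<le> K_weight k G g"
    using continuous_attains_inf[of C "K_weight k G"] by blast
  have cov: "frac_K_cover k G f" using f(1) by (auto simp: C_def frac_K_cover_def)
  have min: "K_weight k G f \<le> K_weight k G g" if "frac_K_cover k G g" for g
  proof -
    define g' where "g' H = (if H \<in> K_sub k G then g H else 0)" for H
    have "K_weight k G g' = K_weight k G g"
      unfolding K_weight_def by (rule sum.cong) (auto simp: g'_def)
    moreover have "(\<Sum>H\<in>K_sub_at k G v. g' H) = (\<Sum>H\<in>K_sub_at k G v. g H)" for v
      by (rule sum.cong) (auto simp: g'_def K_sub_at_def)
    then have "g' \<in> C"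
      using that by (auto simp: C_def frac_K_cover_def) (auto simp: g'_def)
    ultimately show ?thesis using f(2) by metis
  qed
  have "K_cover_f k G = K_weight k G f"
    unfolding K_cover_f_def by (rule cInf_eq_minimum) (use cov min in auto)
  with cov min that show thesis by metis
qed

lemma K_cover_f_eq_1:
  assumes "simple_graph G" "clique_number G < k"
  shows "K_cover_f k G = 1"
proof -
  interpret graph G using assms by (simp add: simple_graph_def)
  have "finite {card W | W. clique G W}"
    by (rule finite_subset[of _ "card ` Pow (verts G)"]) (auto simp: clique_def)
  then have "card W \<le> clique_number G" if "clique G W" for W
    unfolding clique_number_def using that by (intro Max_ge) auto
  then have G: "G \<in> K_sub k G"
    using assms induced_subgraph_refl by (fastforce simp: K_sub_def K_class_def)
  note fin = finite_K_sub[OF assms(1), of k]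
  define f where "f H = (if H = G then 1 else 0 :: real)" for H
  have w: "K_weight k G f = 1"
    using G fin by (simp add: K_weight_def f_def)
  have "(\<Sum>H\<in>K_sub_at k G v. f H) = 1" if "v \<in> verts G" for v
    using G fin that by (simp add: K_sub_at_def f_def)
  then have cov: "frac_K_cover k G f" by (simp add: frac_K_cover_def f_def)
  obtain v where v: "v \<in> verts G" using assms by (auto simp: simple_graph_def)
  have "1 \<le> K_weight k G g" if "frac_K_cover k G g" for g
  proof -
    have "1 \<le> (\<Sum>H\<in>K_sub_at k G v. g H)" using that v by (simp add: frac_K_cover_def)
    also have "\<dots> \<le> K_weight k G g" unfolding K_weight_def
      by (rule sum_mono2) (use fin that in \<open>auto simp: K_sub_at_def frac_K_cover_def\<close>)
    finally show ?thesis .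
  qed
  then show ?thesis
    unfolding K_cover_f_def by (intro cInf_eq_minimum) (use cov w in \<open>auto intro: exI[of _ f]\<close>)
qed

end

theory Submission
  imports Defs
begin

text \<open>
  Pull an optimal fractional cover of \<open>G\<^sub>2\<close> back along \<open>\<theta>\<close>: each \<open>H\<close> is replaced by the subgraph
  of \<open>G\<^sub>1\<close> induced on the preimage of its vertices.  Since \<open>G\<^sub>2\<close> has no loops, \<open>\<theta>\<close> is injective on
  cliques, so this preimage contains no clique larger than those of \<open>H\<close>.  Several \<open>H\<close> may have the
  same preimage; their values are added and the sum is truncated at 1.  Truncation cannot destroy
  the covering property, because a subgraph of value 1 covers its vertices by itself.
\<close>

text \<open>An induced subgraph keeps every arc between its vertices. This allows passing from
  cliques of a pullback to cliques of \<open>G\<^sub>1\<close>, and from image cliques in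
  \<open>G\<^sub>2\<close> back to cliques of \<open>H\<close>.\<close>

lemma clique_induced_subgraph:
  assumes "induced_subgraph H G"
  shows "clique H W \<longleftrightarrow> clique G W \<and> W \<subseteq> verts H"
proof -
  have sub: "verts H \<subseteq> verts G" "tail H = tail G" "head H = head G"
    and arcs: "arcs H = {e \<in> arcs G. tail G e \<in> verts H \<and> head G e \<in> verts H}"
    using assms by (auto simp: induced_subgraph_def subgraph_def compatible_def)
  have "u \<rightarrow>\<^bsub>H\<^esub> v \<longleftrightarrow> u \<rightarrow>\<^bsub>G\<^esub> v" if "u \<in> verts H" "v \<in> verts H" for u v
    using that by (auto simp: arcs_ends_def arc_to_ends_def sub arcs)
  then show ?thesis
    using sub(1) by (auto simp: clique_def subset_iff)
qed

lemma induced_subgraph_simple_graph: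
  assumes "graph G" "induced_subgraph H G" "verts H \<noteq> {}"
  shows "simple_graph H"
proof -
  interpret graph G by fact
  show ?thesis
    using assms by (meson simple_graph_def digraphI_induced graph_def induced_graph_imp_graph
        pseudo_graph_def digraph_def)
qed

lemma graph_hom_clique_image:
  assumes "simple_graph G\<^sub>2" "graph_hom G\<^sub>1 G\<^sub>2 \<theta>" "clique G\<^sub>1 W"
  shows "clique G\<^sub>2 (\<theta> ` W)" and "card (\<theta> ` W) = card W"
proof -
  interpret G\<^sub>2: graph G\<^sub>2 using assms(1) by (simp add: simple_graph_def)
  show "clique G\<^sub>2 (\<theta> ` W)"
    using assms(2,3) by (fastforce simp: clique_def graph_hom_def)
  have "inj_on \<theta> W"
  proof (rule inj_onI, rule ccontr)
    fix u v assume "u \<in> W" "v \<in> W" "\<theta> u = \<theta> v" "u \<noteq> v"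
    then have "\<theta> u \<rightarrow>\<^bsub>G\<^sub>2\<^esub> \<theta> u"
      using assms(2,3) by (metis clique_def graph_hom_def)
    then show False
      using G\<^sub>2.adj_not_same by blast
  qed
  then show "card (\<theta> ` W) = card W"
    by (rule card_image)
qed

text \<open>The result has no vertices when \<open>H\<close> misses the image of
  \<open>\<theta>\<close>; it is then not a \<open>simple_graph\<close>.\<close>

definition pullback ::
  "('a, 'b) pre_digraph \<Rightarrow> ('a \<Rightarrow> 'c) \<Rightarrow> ('c, 'd) pre_digraph \<Rightarrow> ('a, 'b) pre_digraph" where
  "pullback G \<theta> H = G \<restriction> {v \<in> verts G. \<theta> v \<in> verts H}"

lemma verts_pullback [simp]: "verts (pullback G \<theta> H) = {v \<in> verts G. \<theta> v \<in> verts H}"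
  by (simp add: pullback_def)

text \<open>A clique of size \<open>k + 1\<close> in the pullback would map to one of the same size
  in \<open>H\<close>. The vertex \<open>v\<close> witnesses that the pullback is non-empty.\<close>

lemma pullback_in_K_sub:
  assumes "simple_graph G\<^sub>1" "simple_graph G\<^sub>2" "graph_hom G\<^sub>1 G\<^sub>2 \<theta>" "H \<in> K_sub k G\<^sub>2"
    and "v \<in> verts G\<^sub>1" "\<theta> v \<in> verts H"
  shows "pullback G\<^sub>1 \<theta> H \<in> K_sub k G\<^sub>1"
proof -
  interpret G\<^sub>1: graph G\<^sub>1 using assms(1) by (simp add: simple_graph_def)
  have ind: "induced_subgraph (pullback G\<^sub>1 \<theta> H) G\<^sub>1"
    unfolding pullback_def by (rule G\<^sub>1.induced_induce) auto
  have H: "induced_subgraph H G\<^sub>2" "\<And>W. clique H W \<Longrightarrow> card W \<noteq> k + 1"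
    using assms(4) by (auto simp: K_sub_def K_class_def)
  have "card W \<noteq> k + 1" if "clique (pullback G\<^sub>1 \<theta> H) W" for W
  proof -
    have W: "clique G\<^sub>1 W" "\<theta> ` W \<subseteq> verts H"
      using that ind by (auto simp: clique_induced_subgraph)
    then have "clique H (\<theta> ` W)"
      using graph_hom_clique_image(1)[OF assms(2,3)] H(1) by (simp add: clique_induced_subgraph)
    then show ?thesis
      using H(2) graph_hom_clique_image(2)[OF assms(2,3) W(1)] by metis
  qed
  moreover have "verts (pullback G\<^sub>1 \<theta> H) \<noteq> {}"
    using assms(5,6) by auto
  ultimately show ?thesis
    using ind induced_subgraph_simple_graph[OF G\<^sub>1.graph_axioms ind]
    by (auto simp: K_sub_def K_class_def)
qed

text \<open>Either some term is at least 1 and its truncation alone suffices, or truncation changes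
  no term.\<close>

lemma sum_min_one_ge_one:
  fixes s :: "'a \<Rightarrow> real"
  assumes "finite A" "\<And>x. x \<in> A \<Longrightarrow> 0 \<le> s x" "1 \<le> sum s A"
  shows "1 \<le> (\<Sum>x\<in>A. min 1 (s x))"
proof (cases "\<exists>x\<in>A. 1 \<le> s x")
  case True
  then obtain x where "x \<in> A" "1 \<le> s x" by blast
  then have "1 = min 1 (s x)" by simp
  also have "\<dots> \<le> (\<Sum>x\<in>A. min 1 (s x))"
    by (rule member_le_sum) (use \<open>x \<in> A\<close> assms in auto)
  finally show ?thesis .
next
  case False
  then have "(\<Sum>x\<in>A. min 1 (s x)) = sum s A"
    by (intro sum.cong) auto
  then show ?thesis using assms(3) by simp
qed

text \<open>The infimum is the weight of a minimiser, hence a lower bound for all weights.\<close>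

lemma K_cover_f_le:
  assumes "simple_graph G" "k \<ge> 1" "frac_K_cover k G g"
  shows "K_cover_f k G \<le> K_weight k G g"
  using K_cover_f_attained[OF assms(1,2)] assms(3) by metis

theorem corollary2p2:
  fixes G\<^sub>1 :: "('a, 'b) pre_digraph"
    and G\<^sub>2 :: "('c, 'd) pre_digraph"
    and \<theta> :: "'a \<Rightarrow> 'c"
    and k :: nat
  assumes "simple_graph G\<^sub>1" and "simple_graph G\<^sub>2"
    and "graph_hom G\<^sub>1 G\<^sub>2 \<theta>"
    and "k \<ge> 1"
  shows "K_cover_f k G\<^sub>1 \<le> K_cover_f k G\<^sub>2"
proof -
  obtain f where f: "frac_K_cover k G\<^sub>2 f" "K_weight k G\<^sub>2 f = K_cover_f k G\<^sub>2"
    using K_cover_f_attained[OF assms(2,4)] by metis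
  note fin = finite_K_sub[OF assms(1), of k] finite_K_sub[OF assms(2), of k]
  have f0: "0 \<le> f H" if "H \<in> K_sub k G\<^sub>2" for H
    using f(1) that by (simp add: frac_K_cover_def)
  define s where "s K = (\<Sum>H | H \<in> K_sub k G\<^sub>2 \<and> pullback G\<^sub>1 \<theta> H = K. f H)" for K
  define g where "g K = min 1 (s K)" for K
  have s0: "0 \<le> s K" for K
    unfolding s_def using f0 by (intro sum_nonneg) auto
  \<comment> \<open>The fibres of the pullback map over \<open>A\<close> are disjoint. The identity
    serves twice: for the subgraphs containing \<open>v\<close>, to get covering, and for all of
    \<open>K_sub k G\<^sub>1\<close>, to bound the weight.\<close>
  have s_sum: "sum s A = (\<Sum>H | H \<in> K_sub k G\<^sub>2 \<and> pullback G\<^sub>1 \<theta> H \<in> A. f H)"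
    if "finite A" for A
  proof -
    have "sum s A = (\<Sum>K\<in>A. \<Sum>H | H \<in> {H \<in> K_sub k G\<^sub>2. pullback G\<^sub>1 \<theta> H \<in> A} \<and>
        pullback G\<^sub>1 \<theta> H = K. f H)"
      unfolding s_def by (intro sum.cong) auto
    also have "\<dots> = (\<Sum>H | H \<in> K_sub k G\<^sub>2 \<and> pullback G\<^sub>1 \<theta> H \<in> A. f H)"
      by (rule sum.group) (use that fin in auto)
    finally show ?thesis .
  qed
  have "1 \<le> (\<Sum>K\<in>K_sub_at k G\<^sub>1 v. g K)" if v: "v \<in> verts G\<^sub>1" for v
  proof -
    have fin_at: "finite (K_sub_at k G\<^sub>1 v)"
      using fin by (simp add: K_sub_at_def)
    have "\<theta> v \<in> verts G\<^sub>2"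
      using v assms(3) by (simp add: graph_hom_def)
    then have "1 \<le> (\<Sum>H\<in>K_sub_at k G\<^sub>2 (\<theta> v). f H)"
      using f(1) by (simp add: frac_K_cover_def)
    \<comment> \<open>For a vertex \<open>v\<close> of \<open>G\<^sub>1\<close>, the pullback of
      \<open>H\<close> contains \<open>v\<close> iff \<open>H\<close> contains
      \<open>\<theta> v\<close>, and then \<open>v\<close> makes it non-empty.\<close>
    also have "K_sub_at k G\<^sub>2 (\<theta> v) =
        {H. H \<in> K_sub k G\<^sub>2 \<and> pullback G\<^sub>1 \<theta> H \<in> K_sub_at k G\<^sub>1 v}"
      using v pullback_in_K_sub[OF assms(1-3)] by (auto simp: K_sub_at_def)
    finally show ?thesis
      unfolding g_def using s_sum[OF fin_at] s0 fin_at by (intro sum_min_one_ge_one) auto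
  qed
  then have "frac_K_cover k G\<^sub>1 g"
    by (auto simp: frac_K_cover_def g_def s0)
  then have "K_cover_f k G\<^sub>1 \<le> K_weight k G\<^sub>1 g"
    by (rule K_cover_f_le[OF assms(1,4)])
  also have "\<dots> \<le> sum s (K_sub k G\<^sub>1)"
    unfolding K_weight_def g_def by (intro sum_mono) auto
  \<comment> \<open>Only an inequality: any \<open>H\<close> with empty pullback drops out of the
    left side, and its value is nonnegative.\<close>
  also have "\<dots> \<le> K_weight k G\<^sub>2 f"
    unfolding s_sum[OF fin(1)] K_weight_def by (rule sum_mono2) (use fin f0 in auto)
  finally show ?thesis using f(2) by simp
qed

end
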